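(* Let $I=[0,1]$. Let $2I=(I\times\{0\})\cup(\{0\}\times I)$, and let $q_1,q_2:2I\to I$ be defined by $q_1(x)=\alpha$ if $x=(\alpha,0)\in I\times\{0\}$ and $q_1(x)=0$ otherwise, and $q_2(x)=\alpha$ if $x=(0,\alpha)\in\{0\}\times I$ and $q_2(x)=0$ otherwise. Put $\Omega_i=\{\bar 0,q_i,\bar 1\}$ for $i=1,2$. Let $L=\{(a,b)\in I\times I\mid a+b\le 1\}$, let $p_1,p_2:L\to I$ be the projections $p_1(a,b)=a$, $p_2(a,b)=b$, and put $\Delta_1=\{\bar 0,p_1,\bar 1\}$, $\Delta_2=\{\bar 0,\bar 1-p_2,\bar 1\}$. Then the fuzzy bitopological spaces $(2I,\Omega_1,\Omega_2)$ and $(L,\Delta_1,\Delta_2)$ are not homeomorphic.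
   Context: For a set $X$, $\bar 0,\bar 1:X\to I=[0,1]$ denote the constant maps with values $0$ and $1$. A fuzzy topology on $X$ is a family $\tau\subseteq I^X$ closed under arbitrary (pointwise) suprema and finite (pointwise) infima, including the empty ones, so that $\bar 0,\bar 1\in\tau$. A fuzzy bitopological space is a triple $(X,\tau_1,\tau_2)$ with $X$ a set and $\tau_1,\tau_2$ fuzzy topologies on $X$. A map $f:(X,\tau_1,\tau_2)\to(Y,\delta_1,\delta_2)$ is bicontinuous if $f^{\leftarrow}(\nu):=\nu\circ f\in\tau_i$ for every $\nu\in\delta_i$, $i=1,2$. A homeomorphism of fuzzy bitopological spaces is a bijective bicontinuous map whose inverse is bicontinuous; two spaces are homeomorphic if there is a homeomorphism between them. *)

theory Defs
  imports Complex_Main "HOL-Library.FuncSet"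
begin

text \<open>
  A fuzzy set on a carrier \<open>X\<close> is an extensional function in \<open>X \<rightarrow>\<^sub>E {0..1}\<close>, so that two
  fuzzy sets are equal iff they agree on \<open>X\<close>.
\<close>

definition fuzzy_const :: "'a set \<Rightarrow> real \<Rightarrow> 'a \<Rightarrow> real" where
  "fuzzy_const X c = (\<lambda>x\<in>X. c)"

text \<open>
  Suprema and infima are taken in the complete lattice \<open>[0,1]\<close>. Adding the bottom element 0
  (the top element 1) changes nothing for a nonempty family of \<open>[0,1]\<close>-valued functions, and
  gives the correct value for the empty family, where \<open>Sup\<close> and \<open>Inf\<close> on the reals
  are unspecified.
\<close>

definition fuzzy_Sup :: "'a set \<Rightarrow> ('a \<Rightarrow> real) set \<Rightarrow> 'a \<Rightarrow> real" where
  "fuzzy_Sup X S = (\<lambda>x\<in>X. Sup (insert 0 ((\<lambda>\<mu>. \<mu> x) ` S)))"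

definition fuzzy_Inf :: "'a set \<Rightarrow> ('a \<Rightarrow> real) set \<Rightarrow> 'a \<Rightarrow> real" where
  "fuzzy_Inf X S = (\<lambda>x\<in>X. Inf (insert 1 ((\<lambda>\<mu>. \<mu> x) ` S)))"

definition fuzzy_topology :: "'a set \<Rightarrow> ('a \<Rightarrow> real) set \<Rightarrow> bool" where
  "fuzzy_topology X \<tau> \<longleftrightarrow>
     \<tau> \<subseteq> X \<rightarrow>\<^sub>E {0..1} \<and>
     (\<forall>S. S \<subseteq> \<tau> \<longrightarrow> fuzzy_Sup X S \<in> \<tau>) \<and>
     (\<forall>S. S \<subseteq> \<tau> \<and> finite S \<longrightarrow> fuzzy_Inf X S \<in> \<tau>)"

type_synonym 'a fbts = "'a set \<times> ('a \<Rightarrow> real) set \<times> ('a \<Rightarrow> real) set"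

fun fuzzy_bitopological_space :: "'a fbts \<Rightarrow> bool" where
  "fuzzy_bitopological_space (X, \<tau>\<^sub>1, \<tau>\<^sub>2) \<longleftrightarrow> fuzzy_topology X \<tau>\<^sub>1 \<and> fuzzy_topology X \<tau>\<^sub>2"

text \<open>\<open>compose X \<nu> f\<close> is the preimage \<open>\<nu> \<circ> f\<close>, restricted to \<open>X\<close>.\<close>

fun bicontinuous :: "'a fbts \<Rightarrow> 'b fbts \<Rightarrow> ('a \<Rightarrow> 'b) \<Rightarrow> bool" where
  "bicontinuous (X, \<tau>\<^sub>1, \<tau>\<^sub>2) (Y, \<delta>\<^sub>1, \<delta>\<^sub>2) f \<longleftrightarrow>
     f \<in> X \<rightarrow> Y \<and>
     (\<forall>\<nu>\<in>\<delta>\<^sub>1. compose X \<nu> f \<in> \<tau>\<^sub>1) \<and>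
     (\<forall>\<nu>\<in>\<delta>\<^sub>2. compose X \<nu> f \<in> \<tau>\<^sub>2)"

definition fbts_homeomorphism :: "'a fbts \<Rightarrow> 'b fbts \<Rightarrow> ('a \<Rightarrow> 'b) \<Rightarrow> bool" where
  "fbts_homeomorphism S T f \<longleftrightarrow>
     bij_betw f (fst S) (fst T) \<and>
     bicontinuous S T f \<and>
     bicontinuous T S (inv_into (fst S) f)"

definition fbts_homeomorphic :: "'a fbts \<Rightarrow> 'b fbts \<Rightarrow> bool" where
  "fbts_homeomorphic S T \<longleftrightarrow> (\<exists>f. fbts_homeomorphism S T f)"

definition twoI :: "(real \<times> real) set" where
  "twoI = ({0..1} \<times> {0}) \<union> ({0} \<times> {0..1})"

definition q\<^sub>1 :: "real \<times> real \<Rightarrow> real" where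
  "q\<^sub>1 = (\<lambda>x\<in>twoI. if x \<in> {0..1} \<times> {0} then fst x else 0)"

definition q\<^sub>2 :: "real \<times> real \<Rightarrow> real" where
  "q\<^sub>2 = (\<lambda>x\<in>twoI. if x \<in> {0} \<times> {0..1} then snd x else 0)"

definition \<Omega>\<^sub>1 :: "(real \<times> real \<Rightarrow> real) set" where
  "\<Omega>\<^sub>1 = {fuzzy_const twoI 0, q\<^sub>1, fuzzy_const twoI 1}"

definition \<Omega>\<^sub>2 :: "(real \<times> real \<Rightarrow> real) set" where
  "\<Omega>\<^sub>2 = {fuzzy_const twoI 0, q\<^sub>2, fuzzy_const twoI 1}"

definition triL :: "(real \<times> real) set" where
  "triL = {(a, b). a \<in> {0..1} \<and> b \<in> {0..1} \<and> a + b \<le> 1}"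

definition p\<^sub>1 :: "real \<times> real \<Rightarrow> real" where
  "p\<^sub>1 = (\<lambda>x\<in>triL. fst x)"

definition p\<^sub>2 :: "real \<times> real \<Rightarrow> real" where
  "p\<^sub>2 = (\<lambda>x\<in>triL. snd x)"

definition \<Delta>\<^sub>1 :: "(real \<times> real \<Rightarrow> real) set" where
  "\<Delta>\<^sub>1 = {fuzzy_const triL 0, p\<^sub>1, fuzzy_const triL 1}"

definition \<Delta>\<^sub>2 :: "(real \<times> real \<Rightarrow> real) set" where
  "\<Delta>\<^sub>2 = {fuzzy_const triL 0, (\<lambda>x\<in>triL. 1 - p\<^sub>2 x), fuzzy_const triL 1}"

lemma fuzzy_topology_three:
  assumes q: "q \<in> X \<rightarrow>\<^sub>E {0..1}"
  shows "fuzzy_topology X {fuzzy_const X 0, q, fuzzy_const X 1}"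
proof -
  let ?z = "fuzzy_const X 0" and ?o = "fuzzy_const X 1"
  have qb: "0 \<le> q x" "q x \<le> 1" if "x \<in> X" for x
    using PiE_mem[OF q that] by auto
  have qe: "q = (\<lambda>x\<in>X. q x)"
    using q by (simp add: PiE_restrict)
  have sup: "fuzzy_Sup X S \<in> {?z, q, ?o}" if S: "S \<subseteq> {?z, q, ?o}" for S
  proof -
    consider "?o \<in> S" | "?o \<notin> S" "q \<in> S" | "S \<subseteq> {?z}"
      using S by blast
    then show ?thesis
    proof cases
      case 1
      have "Sup (insert 0 ((\<lambda>\<mu>. \<mu> x) ` S)) = 1" if "x \<in> X" for x
        using 1 S that qb[OF that]
        by (intro cSup_eq_maximum) (auto simp: fuzzy_const_def image_iff intro!: bexI[of _ ?o])
      then have "fuzzy_Sup X S = ?o"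
        unfolding fuzzy_Sup_def fuzzy_const_def by (intro restrict_ext) auto
      then show ?thesis by simp
    next
      case 2
      have S': "S \<subseteq> {?z, q}" using S 2 by blast
      have "Sup (insert 0 ((\<lambda>\<mu>. \<mu> x) ` S)) = q x" if "x \<in> X" for x
        using 2 S' that qb[OF that]
        by (intro cSup_eq_maximum) (auto simp: fuzzy_const_def)
      then have "fuzzy_Sup X S = (\<lambda>x\<in>X. q x)"
        unfolding fuzzy_Sup_def by (intro restrict_ext) auto
      then show ?thesis using qe by simp
    next
      case 3
      have "Sup (insert 0 ((\<lambda>\<mu>. \<mu> x) ` S)) = 0" if "x \<in> X" for x
        using 3 that by (intro cSup_eq_maximum) (auto simp: fuzzy_const_def)
      then have "fuzzy_Sup X S = ?z"
        unfolding fuzzy_Sup_def fuzzy_const_def by (intro restrict_ext) auto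
      then show ?thesis by simp
    qed
  qed
  have inf: "fuzzy_Inf X S \<in> {?z, q, ?o}" if S: "S \<subseteq> {?z, q, ?o}" for S
  proof -
    consider "?z \<in> S" | "?z \<notin> S" "q \<in> S" | "S \<subseteq> {?o}"
      using S by blast
    then show ?thesis
    proof cases
      case 1
      have "Inf (insert 1 ((\<lambda>\<mu>. \<mu> x) ` S)) = 0" if "x \<in> X" for x
        using 1 S that qb[OF that]
        by (intro cInf_eq_minimum) (auto simp: fuzzy_const_def image_iff intro!: bexI[of _ ?z])
      then have "fuzzy_Inf X S = ?z"
        unfolding fuzzy_Inf_def fuzzy_const_def by (intro restrict_ext) auto
      then show ?thesis by simp
    next
      case 2
      have S': "S \<subseteq> {q, ?o}" using S 2 by blast
      have "Inf (insert 1 ((\<lambda>\<mu>. \<mu> x) ` S)) = q x" if "x \<in> X" for x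
        using 2 S' that qb[OF that]
        by (intro cInf_eq_minimum) (auto simp: fuzzy_const_def)
      then have "fuzzy_Inf X S = (\<lambda>x\<in>X. q x)"
        unfolding fuzzy_Inf_def by (intro restrict_ext) auto
      then show ?thesis using qe by simp
    next
      case 3
      have "Inf (insert 1 ((\<lambda>\<mu>. \<mu> x) ` S)) = 1" if "x \<in> X" for x
        using 3 that by (intro cInf_eq_minimum) (auto simp: fuzzy_const_def)
      then have "fuzzy_Inf X S = ?o"
        unfolding fuzzy_Inf_def fuzzy_const_def by (intro restrict_ext) auto
      then show ?thesis by simp
    qed
  qed
  have "{?z, q, ?o} \<subseteq> X \<rightarrow>\<^sub>E {0..1}"
    using q by (auto simp: fuzzy_const_def)
  with sup inf show ?thesis
    unfolding fuzzy_topology_def by blast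
qed

lemma fuzzy_bitopological_space_twoI: "fuzzy_bitopological_space (twoI, \<Omega>\<^sub>1, \<Omega>\<^sub>2)"
proof -
  have "q\<^sub>1 \<in> twoI \<rightarrow>\<^sub>E {0..1}" "q\<^sub>2 \<in> twoI \<rightarrow>\<^sub>E {0..1}"
    by (auto simp: q\<^sub>1_def q\<^sub>2_def twoI_def)
  then show ?thesis
    by (simp add: \<Omega>\<^sub>1_def \<Omega>\<^sub>2_def fuzzy_topology_three)
qed

lemma fuzzy_bitopological_space_triL: "fuzzy_bitopological_space (triL, \<Delta>\<^sub>1, \<Delta>\<^sub>2)"
proof -
  have "p\<^sub>1 \<in> triL \<rightarrow>\<^sub>E {0..1}" "(\<lambda>x\<in>triL. 1 - p\<^sub>2 x) \<in> triL \<rightarrow>\<^sub>E {0..1}"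
    by (auto simp: p\<^sub>1_def p\<^sub>2_def triL_def)
  then show ?thesis
    by (simp add: \<Delta>\<^sub>1_def \<Delta>\<^sub>2_def fuzzy_topology_three)
qed

end

theory Submission
  imports Defs
begin

text \<open>\<open>twoI\<close> is a union of two axes, so \<open>q\<^sub>1\<close> and
  \<open>q\<^sub>2\<close> are never both positive. In \<open>triL\<close>, \<open>p\<^sub>1\<close>
  and 1 - \<open>p\<^sub>2\<close> both equal 1/2 at (1/2, 1/2); a homeomorphism would carry this
  over to \<open>q\<^sub>1\<close> and \<open>q\<^sub>2\<close> at the preimage point.\<close>

lemma q\<^sub>1_eq_0_or_q\<^sub>2_eq_0:
  assumes "x \<in> twoI"
  shows "q\<^sub>1 x = 0 \<or> q\<^sub>2 x = 0"
  using assms by (auto simp: q\<^sub>1_def q\<^sub>2_def twoI_def)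

theorem theorem3p2:
  shows "\<not> fbts_homeomorphic (twoI, \<Omega>\<^sub>1, \<Omega>\<^sub>2) (triL, \<Delta>\<^sub>1, \<Delta>\<^sub>2)"
proof
  assume "fbts_homeomorphic (twoI, \<Omega>\<^sub>1, \<Omega>\<^sub>2) (triL, \<Delta>\<^sub>1, \<Delta>\<^sub>2)"
  then obtain f where bij: "bij_betw f twoI triL"
    and bic: "bicontinuous (twoI, \<Omega>\<^sub>1, \<Omega>\<^sub>2) (triL, \<Delta>\<^sub>1, \<Delta>\<^sub>2) f"
    unfolding fbts_homeomorphic_def fbts_homeomorphism_def by auto
  \<comment> \<open>Both nonconstant open fuzzy sets of \<open>triL\<close> take the value 1/2 at this point, so neither
    pulls back to a constant.\<close>
  let ?y = "(1/2, 1/2) :: real \<times> real"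
  have y: "?y \<in> triL"
    by (simp add: triL_def)
  then obtain x where x: "x \<in> twoI" "f x = ?y"
    using bij_betw_imp_surj_on[OF bij] by (metis imageE)
  have "compose twoI p\<^sub>1 f \<in> \<Omega>\<^sub>1" "compose twoI (\<lambda>x\<in>triL. 1 - p\<^sub>2 x) f \<in> \<Omega>\<^sub>2"
    using bic by (auto simp: \<Delta>\<^sub>1_def \<Delta>\<^sub>2_def)
  moreover have "compose twoI p\<^sub>1 f x = 1/2" "compose twoI (\<lambda>x\<in>triL. 1 - p\<^sub>2 x) f x = 1/2"
    using x y by (simp_all add: compose_eq p\<^sub>1_def p\<^sub>2_def)
  \<comment> \<open>The value 1/2 rules out the constants 0 and 1, so the pullbacks are
    \<open>q\<^sub>1\<close> and \<open>q\<^sub>2\<close> themselves.\<close>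
  ultimately have "q\<^sub>1 x = 1/2" "q\<^sub>2 x = 1/2"
    using x(1) by (auto simp: \<Omega>\<^sub>1_def \<Omega>\<^sub>2_def fuzzy_const_def)
  with q\<^sub>1_eq_0_or_q\<^sub>2_eq_0[OF x(1)] show False
    by simp
qed

end
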